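(* Let $(G,\cdot)$ be a Polish, locally compact, $\sigma$-compact group with a non-atomic left Haar measure $\alpha$. Let $X_1,\dots,X_n$ be independent $G$-valued random variables with density functions $f_1,\dots,f_n$ with respect to $\alpha$. Then $$M(X_1\cdots X_n)\le\sup M(U_1\cdots U_n),$$ where the supremum is taken over all independent $G$-valued random variables $U_1,\dots,U_n$ with $U_i$ uniformly distributed on a (measurable) subset of $G$ chosen so that $M(U_i)=M(X_i)$ (with the understanding that $U_i$ has a Dirac delta distribution if $M(X_i)=\infty$).
   Context: For a $G$-valued random variable $Y$, $M(Y)=\sup\{\mathbb{P}(Y\in A)/\alpha(A): A\text{ Borel},\ \alpha(A)>0\}\in[0,\infty]$; if finite, it is the essential supremum of the density of $Y$ with respect to $\alpha$. $X_1\cdots X_n$ denotes the product in the group $G$. "Uniformly distributed on a subset $S$" means having density $\alpha(S)^{-1}\mathbf{1}_S$ with respect to $\alpha$, so that $M(U_i)=1/\alpha(S)$. *)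

theory Defs
  imports "HOL-Probability.Probability"
begin

text \<open>
  The group is written additively, as the library's class \<open>topological_group_add\<close> does;
  neither this class nor \<open>group_add\<close> assumes commutativity. Thus \<open>x + y\<close> is the
  group product and \<open>sum_list\<close> is the ordered product of a list. The class \<open>polish_space\<close>
  carries a complete metric, which need not be related to the group operation.
\<close>

definition sigma_compact :: "'a::topological_space set \<Rightarrow> bool" where
  "sigma_compact S \<longleftrightarrow> (\<exists>K :: nat \<Rightarrow> 'a set. (\<forall>n. compact (K n)) \<and> (\<Union>n. K n) = S)"

text \<open>A left Haar measure: a nonzero left-invariant Radon measure on the Borel sets.\<close>

definition left_haar_measure :: "'a::topological_group_add measure \<Rightarrow> bool" where
  "left_haar_measure \<alpha> \<longleftrightarrow>
     sets \<alpha> = sets borel \<and>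
     emeasure \<alpha> UNIV \<noteq> 0 \<and>
     (\<forall>g. \<forall>A\<in>sets borel. emeasure \<alpha> ((\<lambda>x. g + x) ` A) = emeasure \<alpha> A) \<and>
     (\<forall>K. compact K \<longrightarrow> emeasure \<alpha> K < \<infinity>) \<and>
     (\<forall>A\<in>sets borel. emeasure \<alpha> A = (INF V\<in>{V. open V \<and> A \<subseteq> V}. emeasure \<alpha> V)) \<and>
     (\<forall>V. open V \<longrightarrow> emeasure \<alpha> V = (SUP K\<in>{K. compact K \<and> K \<subseteq> V}. emeasure \<alpha> K))"

definition non_atomic :: "'a measure \<Rightarrow> bool" where
  "non_atomic \<mu> \<longleftrightarrow>
     (\<forall>A\<in>sets \<mu>. 0 < emeasure \<mu> A \<longrightarrow>
        (\<exists>B\<in>sets \<mu>. B \<subseteq> A \<and> 0 < emeasure \<mu> B \<and> emeasure \<mu> B < emeasure \<mu> A))"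

text \<open>
  \<open>max_density \<alpha> P Y\<close> is the quantity M(Y) of a random variable \<open>Y\<close> on \<open>P\<close>. In \<open>ennreal\<close>,
  \<open>p / \<infinity> = 0\<close> for finite \<open>p\<close>, so sets of infinite measure contribute 0.
\<close>

definition max_density ::
  "'a::topological_space measure \<Rightarrow> 'b measure \<Rightarrow> ('b \<Rightarrow> 'a) \<Rightarrow> ennreal" where
  "max_density \<alpha> P Y =
     (SUP A\<in>{A\<in>sets borel. 0 < emeasure \<alpha> A}.
        emeasure P (Y -` A \<inter> space P) / emeasure \<alpha> A)"

definition uniform_rv_on ::
  "'a::topological_space measure \<Rightarrow> 'b measure \<Rightarrow> ('b \<Rightarrow> 'a) \<Rightarrow> 'a set \<Rightarrow> bool" where
  "uniform_rv_on \<alpha> P U S \<longleftrightarrow>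
     S \<in> sets borel \<and> 0 < emeasure \<alpha> S \<and> emeasure \<alpha> S < \<infinity> \<and>
     distributed P \<alpha> U (\<lambda>x. indicator S x / emeasure \<alpha> S)"

text \<open>
  \<open>U\<close> is an admissible competitor for a variable whose maximal density is \<open>m\<close>.
  The location of the Dirac mass is left free.
\<close>

definition uniform_with_max_density ::
  "'a::topological_space measure \<Rightarrow> 'b measure \<Rightarrow> ('b \<Rightarrow> 'a) \<Rightarrow> ennreal \<Rightarrow> bool" where
  "uniform_with_max_density \<alpha> P U m \<longleftrightarrow>
     (if m = \<infinity> then (\<exists>x. distr P borel U = return borel x)
      else (\<exists>S. uniform_rv_on \<alpha> P U S) \<and> max_density \<alpha> P U = m)"

definition ordered_product :: "nat \<Rightarrow> (nat \<Rightarrow> 'b \<Rightarrow> 'a::monoid_add) \<Rightarrow> 'b \<Rightarrow> 'a" where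
  "ordered_product n X \<omega> = sum_list (map (\<lambda>i. X i \<omega>) [1..<Suc n])"

text \<open>
  The tuples of independent random variables over which the supremum is taken. HOL cannot
  quantify over all sample-space types inside a formula; the type \<open>nat \<Rightarrow> 'a\<close> is enough, since
  \<open>max_density\<close> of the product depends only on the laws of the \<open>U i\<close>, and every family of laws is
  realised by the coordinate maps on the product measure \<open>PiM {1..n}\<close>.
\<close>

definition uniform_competitors ::
  "'a::topological_space measure \<Rightarrow> nat \<Rightarrow> (nat \<Rightarrow> ennreal)
     \<Rightarrow> ((nat \<Rightarrow> 'a) measure \<times> (nat \<Rightarrow> (nat \<Rightarrow> 'a) \<Rightarrow> 'a)) set" where
  "uniform_competitors \<alpha> n m =
     {(Q, U). prob_space Q \<and> prob_space.indep_vars Q (\<lambda>_. borel) U {1..n} \<and>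
        (\<forall>i\<in>{1..n}. uniform_with_max_density \<alpha> Q (U i) (m i))}"

end

theory Submission
  imports Defs
begin

text \<open>
  Fix a Borel set \<open>A\<close> of positive finite Haar measure. As a function of the laws of
  \<open>X 1, \<dots>, X n\<close>, the probability that the product lies in \<open>A\<close> is affine in each law separately:
  by Fubini it equals the integral of some measurable function \<open>h\<close> with values in \<open>[0, 1]\<close> against
  the \<open>i\<close>-th law, where \<open>h\<close> depends only on \<open>A\<close> and on the other laws. So the laws can be replaced
  one after another by extremal ones (\<open>replace_laws_one_by_one\<close>), provided that for every such \<open>h\<close>
  some extremal law has an integral at least as large, up to an error \<open>e\<close>.

  If the maximal density \<open>m\<close> of the \<open>i\<close>-th variable is infinite, the extremal laws are the Dirac
  masses, and a point where \<open>h\<close> almost reaches its mean will do. If \<open>m\<close> is finite, the density is at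
  most \<open>m\<close> almost everywhere (\<open>density_le_max_density_AE\<close>), and the bathtub principle
  (\<open>bathtub_uniform_density\<close>) says that the integral of \<open>h\<close> against a density bounded by \<open>m\<close> is
  largest when the mass is piled up to the level \<open>m\<close> where \<open>h\<close> is large, that is, for the uniform
  law on a set \<open>S\<close> of measure \<open>1 / m\<close> that is squeezed between superlevel sets of \<open>h\<close>. A set with
  exactly this measure exists because a non-atomic measure takes all intermediate values
  (\<open>non_atomic_intermediate_value\<close>, a theorem of Sierpinski).

  The competitors obtained in this way depend on \<open>A\<close> and on the error, which is harmless under the
  supremum: dividing by the measure of \<open>A\<close>, letting the error tend to 0 and taking the supremum
  over \<open>A\<close> gives the claim.
\<close>

section \<open>Non-atomic measures take all intermediate values\<close>

text \<open>
  Splitting a set of finite positive measure into two parts of positive measure leaves a part with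
  at most half of the measure; iterating makes the measure as small as desired. Passing
  first to some subset of strictly smaller measure ensures finiteness.
\<close>
lemma non_atomic_small_subset:
  assumes na: "non_atomic M" and A: "A \<in> sets M" "0 < emeasure M A" and e: "0 < e"
  shows "\<exists>B\<in>sets M. B \<subseteq> A \<and> 0 < emeasure M B \<and> emeasure M B < ennreal e"
proof -
  obtain A0 where A0: "A0 \<in> sets M" "A0 \<subseteq> A" "0 < emeasure M A0" "emeasure M A0 < emeasure M A"
    using na A unfolding non_atomic_def by blast
  then have "emeasure M A0 < top"
    using top.not_eq_extremum by fastforce
  then obtain r where r: "0 \<le> r" "emeasure M A0 = ennreal r"
    by (metis less_top_ennreal)
  have halve: "\<exists>B\<in>sets M. B \<subseteq> A \<and> 0 < emeasure M B \<and> emeasure M B \<le> ennreal (r / 2 ^ k)" for k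
  proof (induction k)
    case 0
    then show ?case using A0 r by auto
  next
    case (Suc k)
    then obtain B where B: "B \<in> sets M" "B \<subseteq> A" "0 < emeasure M B"
      "emeasure M B \<le> ennreal (r / 2 ^ k)" by auto
    obtain C where C: "C \<in> sets M" "C \<subseteq> B" "0 < emeasure M C" "emeasure M C < emeasure M B"
      using na B unfolding non_atomic_def by blast
    have sum: "emeasure M C + emeasure M (B - C) = emeasure M B"
      using B C by (subst plus_emeasure) (auto simp: Un_absorb1)
    have fin: "emeasure M B < top"
      using B(4) by (auto simp: order_le_less_trans)
    then obtain b where b: "0 \<le> b" "emeasure M B = ennreal b" by (metis less_top_ennreal)
    obtain c where c: "0 \<le> c" "emeasure M C = ennreal c"
      using C(4) fin by (metis less_top_ennreal order.strict_trans)
    have "emeasure M (B - C) \<le> emeasure M B" using B by (intro emeasure_mono) auto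
    then obtain d where d: "0 \<le> d" "emeasure M (B - C) = ennreal d"
      using fin by (metis less_top_ennreal order.strict_trans1)
    have cd: "c + d = b" using sum b c d by (simp flip: ennreal_plus)
    have "b \<le> r / 2 ^ k" using B(4) b r by simp
    moreover have "0 < c" "c < b" using C(3,4) c b by (auto simp: ennreal_less_iff)
    ultimately have "(c \<le> r / 2 ^ Suc k \<or> d \<le> r / 2 ^ Suc k) \<and> 0 < d"
      using cd by (auto simp: field_simps)
    then show ?case
    proof (elim disjE conjE)
      assume "c \<le> r / 2 ^ Suc k"
      then show ?case using B C c by (intro bexI[of _ C]) (auto simp: ennreal_leI)
    next
      assume "d \<le> r / 2 ^ Suc k" "0 < d"
      then show ?case using B C d \<open>0 < d\<close>
        by (intro bexI[of _ "B - C"]) (auto simp: ennreal_leI)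
    qed
  qed
  obtain k where "(1/2) ^ k < e / (r + 1)"
    using real_arch_pow_inv[of "e / (r + 1)" "1/2"] e r by auto
  then have "r / 2 ^ k < e"
    using r e by (auto simp: field_simps power_divide)
  then have "ennreal (r / 2 ^ k) < ennreal e"
    using r by (simp add: ennreal_less_iff)
  with halve[of k] show ?thesis by (metis order.strict_trans1)
qed

text \<open>
  A greedy construction: starting from \<open>T\<close>, enlarge the current set, among the admissible sets of
  measure at most \<open>c\<close> inside \<open>R\<close>, by at least half of the possible gain in measure. If the union
  \<open>U\<close> of these sets had measure less than \<open>c\<close>, a small piece of \<open>R - U\<close> could have been added at
  every step; then every gain would be at least half of the measure of this piece, although the
  gains tend to 0.
\<close>
lemma non_atomic_intermediate_value:
  assumes na: "non_atomic M"
    and sets[measurable]: "T \<in> sets M" "R \<in> sets M" and "T \<subseteq> R"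
    and T: "emeasure M T \<le> ennreal c" and R: "ennreal c \<le> emeasure M R"
  shows "\<exists>S\<in>sets M. T \<subseteq> S \<and> S \<subseteq> R \<and> emeasure M S = ennreal c"
proof -
  define adm where "adm S \<longleftrightarrow> S \<in> sets M \<and> T \<subseteq> S \<and> S \<subseteq> R \<and> emeasure M S \<le> ennreal c" for S
  \<comment> \<open>The relation \<open>good\<close> says that the gain from \<open>S\<close> to \<open>S'\<close> is at least half of the gain to any
    admissible \<open>W\<close>, with the differences rearranged so that no subtraction occurs.\<close>
  define good where "good S S' \<longleftrightarrow> S \<subseteq> S' \<and>
    (\<forall>W. adm W \<longrightarrow> S \<subseteq> W \<longrightarrow> emeasure M W + emeasure M S \<le> emeasure M S' + emeasure M S')" for S S'
  have step: "\<exists>S'. adm S' \<and> good S S'" if S: "adm S" for S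
  proof -
    define s where "s = (SUP W\<in>{W. adm W \<and> S \<subseteq> W}. emeasure M W)"
    have up: "emeasure M W \<le> s" if "adm W" "S \<subseteq> W" for W
      unfolding s_def using that by (auto intro: SUP_upper)
    have "s \<le> ennreal c"
      unfolding s_def by (rule SUP_least) (auto simp: adm_def)
    then have "s < top" by (auto simp: order_le_less_trans)
    then obtain a where a: "0 \<le> a" "s = ennreal a" by (metis less_top_ennreal)
    have "emeasure M S < top" using S by (auto simp: adm_def order_le_less_trans)
    then obtain b where b: "0 \<le> b" "emeasure M S = ennreal b" by (metis less_top_ennreal)
    have ba: "b \<le> a" using up[OF S] a b by simp
    show ?thesis
    proof (cases "a = b")
      case True
      then have "good S S" using up a b unfolding good_def by (auto intro!: add_mono)
      with S show ?thesis by blast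
    next
      case False
      then have "ennreal ((a + b) / 2) < s"
        using a b ba by (simp add: ennreal_less_iff)
      then obtain S' where S': "adm S'" "S \<subseteq> S'" "ennreal ((a + b) / 2) < emeasure M S'"
        unfolding s_def less_SUP_iff by auto
      have "emeasure M W + emeasure M S \<le> emeasure M S' + emeasure M S'"
        if "adm W" "S \<subseteq> W" for W
      proof -
        have "emeasure M W + emeasure M S \<le> ennreal a + ennreal b"
          using up[OF that] a b by (auto intro!: add_mono)
        also have "\<dots> = ennreal ((a + b) / 2) + ennreal ((a + b) / 2)"
          using a b by (simp flip: ennreal_plus)
        also have "\<dots> \<le> emeasure M S' + emeasure M S'"
          using S'(3) by (intro add_mono) auto
        finally show ?thesis .
      qed
      with S' show ?thesis unfolding good_def by blast
    qed
  qed
  have "adm T" using T \<open>T \<subseteq> R\<close> by (auto simp: adm_def)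
  then obtain S where S: "\<And>n::nat. adm (S n)" "\<And>n. good (S n) (S (Suc n))"
    using dependent_nat_choice[of "\<lambda>_. adm" "\<lambda>_. good"] step by metis
  have [measurable]: "S n \<in> sets M" for n using S(1) by (auto simp: adm_def)
  have "incseq S" using S(2) by (auto simp: incseq_Suc_iff good_def)
  define U where "U = (\<Union>n. S n)"
  have [measurable]: "U \<in> sets M" unfolding U_def by measurable
  have lim: "(\<lambda>n. emeasure M (S n)) \<longlonglongrightarrow> emeasure M U"
    unfolding U_def using \<open>incseq S\<close> by (intro Lim_emeasure_incseq) auto
  have U: "adm U"
    using S(1) lim unfolding adm_def
    by (auto simp: U_def intro: LIMSEQ_le_const2)
  have "emeasure M U = ennreal c"
  proof (rule ccontr)
    assume "emeasure M U \<noteq> ennreal c"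
    then have less: "emeasure M U < ennreal c" using U by (auto simp: adm_def)
    then obtain u where u: "0 \<le> u" "emeasure M U = ennreal u" "u < c"
      by (metis ennreal_less_iff less_top_ennreal order.strict_trans ennreal_less_top)
    have "emeasure M U + emeasure M (R - U) = emeasure M R"
      using U by (subst plus_emeasure) (auto simp: adm_def Un_absorb1)
    then have "0 < emeasure M (R - U)"
      using less R by (cases "emeasure M (R - U) = 0") (auto simp: zero_less_iff_neq_zero)
    from non_atomic_small_subset[OF na _ this, of "c - u"] u
    obtain E where E: "E \<in> sets M" "E \<subseteq> R - U" "0 < emeasure M E" "emeasure M E < ennreal (c - u)"
      by auto
    have UE: "emeasure M (U \<union> E) = emeasure M U + emeasure M E"
      using E by (subst plus_emeasure) auto
    also have "\<dots> \<le> ennreal u + ennreal (c - u)"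
      using E u by (intro add_mono) auto
    also have "\<dots> = ennreal c" using u by (simp flip: ennreal_plus)
    finally have "adm (U \<union> E)" using U E unfolding adm_def by auto
    then have "emeasure M (U \<union> E) + emeasure M (S n) \<le> emeasure M (S (Suc n)) + emeasure M (S (Suc n))" for n
      using S(2)[of n] unfolding good_def by (auto simp: U_def)
    moreover have "(\<lambda>n. emeasure M (U \<union> E) + emeasure M (S n)) \<longlonglongrightarrow> emeasure M (U \<union> E) + emeasure M U"
      by (intro tendsto_add tendsto_const lim)
    moreover have "(\<lambda>n. emeasure M (S (Suc n)) + emeasure M (S (Suc n))) \<longlonglongrightarrow> emeasure M U + emeasure M U"
      by (intro tendsto_add LIMSEQ_Suc lim)
    ultimately have "emeasure M (U \<union> E) + emeasure M U \<le> emeasure M U + emeasure M U"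
      by (meson LIMSEQ_le)
    then have "emeasure M (U \<union> E) \<le> emeasure M U"
      using u by (metis add.commute ennreal_add_left_cancel_le ennreal_neq_top infinity_ennreal_def)
    then show False
      using UE u E(3) ennreal_add_left_cancel_le[of "ennreal u" "emeasure M E" 0] by auto
  qed
  with U show ?thesis unfolding adm_def by blast
qed

section \<open>Extremal laws for the integral of a bounded function\<close>

text \<open>
  The pointwise form of the bathtub principle: the inequality \<open>(m - f) * (h + \<epsilon> - t) \<ge> 0\<close>, multiplied
  out without subtraction, where the term \<open>f * \<epsilon>\<close> on the smaller side is dropped.
\<close>
lemma exchange_ineq_ennreal:
  fixes f m h t \<epsilon> :: ennreal
  assumes "f \<le> m" "t \<le> h + \<epsilon>"
  shows "f * h + m * t \<le> m * h + m * \<epsilon> + f * t"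
proof -
  define d where "d = m - f"
  have m: "m = f + d" using assms(1) by (simp add: d_def add_diff_inverse_ennreal)
  have "d * t \<le> d * (h + \<epsilon>)" using assms(2) by (rule mult_left_mono) simp
  then have "f * h + m * t \<le> f * h + f * t + d * (h + \<epsilon>)"
    unfolding m by (simp add: algebra_simps add_left_mono)
  also have "\<dots> \<le> f * h + f * t + d * (h + \<epsilon>) + f * \<epsilon>" by simp
  also have "\<dots> = m * h + m * \<epsilon> + f * t" unfolding m by (simp add: algebra_simps)
  finally show ?thesis .
qed

text \<open>
  Let \<open>g\<close> be the uniform density on a set \<open>S\<close> of measure \<open>c\<close> with \<open>{h > t} \<subseteq> S\<close> and \<open>h \<ge> t - e\<close> on \<open>S\<close>.
  Where \<open>g > f\<close> one is inside \<open>S\<close>, so \<open>h\<close> is at least \<open>t - e\<close>; outside \<open>S\<close>, \<open>h\<close> is at most \<open>t\<close>. As \<open>f\<close> and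
  \<open>g\<close> have the same integral, moving mass from \<open>f\<close> to \<open>g\<close> costs at most \<open>e\<close>. The slack is there because an
  optimal \<open>S\<close> need not exist: if \<open>{h > s}\<close> has infinite measure for all \<open>s < t\<close> while \<open>{h \<ge> t}\<close> is a
  null set, the mean of \<open>h\<close> over sets of measure \<open>c\<close> comes arbitrarily close to \<open>t\<close> without reaching it.
\<close>
lemma bathtub_uniform_density:
  assumes na: "non_atomic M"
    and [measurable]: "f \<in> borel_measurable M" "h \<in> borel_measurable M"
    and f1: "(\<integral>\<^sup>+x. f x \<partial>M) = 1" and fc: "AE x in M. f x \<le> 1 / ennreal c"
    and c: "0 < c" "ennreal c \<le> emeasure M (space M)"
    and h1: "\<And>x. h x \<le> 1" and e: "0 < e"
  shows "\<exists>S\<in>sets M. emeasure M S = ennreal c \<and>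
    (\<integral>\<^sup>+x. f x * h x \<partial>M) \<le> (\<integral>\<^sup>+x. (indicator S x / emeasure M S) * h x \<partial>M) + ennreal e"
proof -
  define T where "T k = {x\<in>space M. ennreal (real k * e) < h x}" for k :: nat
  have [measurable]: "T k \<in> sets M" for k unfolding T_def by measurable
  \<comment> \<open>The level \<open>t\<close> is searched only among the multiples of \<open>e\<close>: it is the first one whose superlevel
    set has measure at most \<open>c\<close>. The superlevel set one step below is then too large, except at level
    0, where the whole space takes its place.\<close>
  obtain k0 where "1 < real k0 * e" using e reals_Archimedean3 by blast
  then have "T k0 = {}" unfolding T_def using h1
    by (auto simp: not_less intro!: order_trans[OF h1] simp flip: ennreal_1)
  then have ex: "emeasure M (T k0) \<le> ennreal c" by simp
  define k where "k = (LEAST k. emeasure M (T k) \<le> ennreal c)"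
  have Tk: "emeasure M (T k) \<le> ennreal c" unfolding k_def using ex by (rule LeastI)
  define R where "R = (if k = 0 then space M else T (k - 1))"
  have [measurable]: "R \<in> sets M" unfolding R_def by simp
  have Rc: "ennreal c \<le> emeasure M R"
  proof (cases "k = 0")
    case False
    then have "\<not> emeasure M (T (k - 1)) \<le> ennreal c"
      unfolding k_def by (intro not_less_Least) auto
    with False show ?thesis by (simp add: R_def)
  qed (use c in \<open>simp add: R_def\<close>)
  have "ennreal (real (k - 1) * e) \<le> ennreal (real k * e)"
    using e by (intro ennreal_leI mult_right_mono) auto
  then have "T k \<subseteq> R"
    unfolding R_def T_def by (auto intro: order.strict_trans1)
  from non_atomic_intermediate_value[OF na _ _ this Tk Rc]
  obtain S where S[measurable]: "S \<in> sets M" and TS: "T k \<subseteq> S" and SR: "S \<subseteq> R"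
    and Sc: "emeasure M S = ennreal c" by auto
  define t where "t = ennreal (real k * e)"
  define g where "g x = indicator S x / emeasure M S" for x
  have g_meas[measurable]: "g \<in> borel_measurable M" unfolding g_def by measurable
  have g1: "(\<integral>\<^sup>+x. g x \<partial>M) = 1"
    unfolding g_def by (subst nn_integral_divide) (use c Sc in auto)
  have lo: "t \<le> h x + ennreal e" if "x \<in> S" for x
  proof (cases "k = 0")
    case False
    then have "ennreal (real (k - 1) * e) < h x" using SR that by (auto simp: R_def T_def)
    then have "ennreal (real (k - 1) * e) + ennreal e \<le> h x + ennreal e"
      by (intro add_mono) auto
    moreover have "ennreal (real (k - 1) * e) + ennreal e = t"
      unfolding t_def using e False by (subst ennreal_plus[symmetric]) (auto simp: algebra_simps of_nat_diff)
    ultimately show ?thesis by (simp only:)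
  qed (simp add: t_def)
  have hi: "h x \<le> t" if "x \<in> space M" "x \<notin> S" for x
    using TS that by (auto simp: T_def t_def not_less)
  have "AE x in M. f x * h x + g x * t \<le> g x * h x + g x * ennreal e + f x * t"
    using fc AE_space
  proof eventually_elim
    case (elim x)
    show ?case
    proof (cases "x \<in> S")
      case True
      then show ?thesis
        using exchange_ineq_ennreal[OF _ lo, of "f x" "g x" x] elim Sc by (simp add: g_def)
    next
      case False
      then show ?thesis using hi[OF elim(2) False] by (simp add: g_def mult_left_mono)
    qed
  qed
  then have "(\<integral>\<^sup>+x. f x * h x + g x * t \<partial>M) \<le> (\<integral>\<^sup>+x. g x * h x + g x * ennreal e + f x * t \<partial>M)"
    by (rule nn_integral_mono_AE)
  then have "(\<integral>\<^sup>+x. f x * h x \<partial>M) + t \<le> (\<integral>\<^sup>+x. g x * h x \<partial>M) + ennreal e + t"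
    by (simp add: nn_integral_add nn_integral_multc f1 g1)
  then have "(\<integral>\<^sup>+x. f x * h x \<partial>M) \<le> (\<integral>\<^sup>+x. g x * h x \<partial>M) + ennreal e"
    using ennreal_add_left_cancel_le[of t] by (simp add: add.commute[of _ t] t_def)
  with S Sc show ?thesis unfolding g_def by blast
qed

text \<open>
  The counterpart of the bathtub principle for unbounded densities, where the extremal laws are Dirac
  masses: \<open>h\<close> cannot stay below its mean by more than \<open>e\<close> everywhere.
\<close>
lemma exists_point_ge_nn_integral:
  assumes "prob_space \<mu>" and h1: "\<And>x. h x \<le> (1::ennreal)" and e: "0 < e"
  shows "\<exists>x. (\<integral>\<^sup>+y. h y \<partial>\<mu>) \<le> h x + ennreal e"
proof (rule ccontr)
  interpret prob_space \<mu> by fact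
  define I where "I = (\<integral>\<^sup>+y. h y \<partial>\<mu>)"
  assume "\<not> ?thesis"
  then have hI: "h x + ennreal e \<le> I" for x unfolding I_def by (simp add: not_le less_imp_le)
  have le: "h x \<le> I - ennreal e" for x
    using hI[of x] by (metis ennreal_le_minus_iff)
  have eI: "ennreal e \<le> I"
    using hI by (metis add.commute le_iff_add order_trans)
  have "I \<le> (\<integral>\<^sup>+y. 1 \<partial>\<mu>)" unfolding I_def by (intro nn_integral_mono h1)
  then have fin: "I < top" by (simp add: emeasure_space_1 order_le_less_trans)
  have "I \<le> (\<integral>\<^sup>+y. I - ennreal e \<partial>\<mu>)" unfolding I_def
    by (intro nn_integral_mono) (use le I_def in auto)
  then have "I \<le> I - ennreal e" by (simp add: emeasure_space_1)
  then show False using fin eI e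
    by (metis ennreal_minus_eq_0 ennreal_between diff_less_top_ennreal ennreal_eq_0_iff leD le_zero_eq less_le not_less)
qed

section \<open>Replacing the factors of a product measure\<close>

text \<open>
  Induction on the set \<open>J\<close> of indices whose law has already been replaced. Integrating out all other
  coordinates turns \<open>F\<close> into a function \<open>h\<close> of the coordinate \<open>j\<close> alone; as \<open>h\<close> does not involve the
  \<open>j\<close>-th law, it represents the integral of \<open>F\<close> before and after the replacement of that law.
\<close>
lemma replace_laws_one_by_one:
  fixes \<mu> :: "'i \<Rightarrow> 'a::topological_space measure" and C :: "'i \<Rightarrow> 'a measure set"
  assumes I: "finite I"
    and \<mu>: "\<And>i. prob_space (\<mu> i)" "\<And>i. sets (\<mu> i) = sets borel"
    and C: "\<And>i \<nu>. i \<in> I \<Longrightarrow> \<nu> \<in> C i \<Longrightarrow> prob_space \<nu> \<and> sets \<nu> = sets borel"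
    and improve: "\<And>i h. i \<in> I \<Longrightarrow> h \<in> borel_measurable borel \<Longrightarrow> (\<And>x. h x \<le> 1) \<Longrightarrow>
      \<exists>\<nu>\<in>C i. (\<integral>\<^sup>+x. h x \<partial>\<mu> i) \<le> (\<integral>\<^sup>+x. h x \<partial>\<nu>) + ennreal e"
    and F: "F \<in> borel_measurable (PiM I (\<lambda>_. borel))" "\<And>x. F x \<le> (1::ennreal)"
    and e: "0 \<le> e"
  shows "\<exists>\<nu>. (\<forall>i. prob_space (\<nu> i)) \<and> (\<forall>i. sets (\<nu> i) = sets borel) \<and> (\<forall>i\<in>I. \<nu> i \<in> C i) \<and>
    (\<integral>\<^sup>+x. F x \<partial>PiM I \<mu>) \<le> (\<integral>\<^sup>+x. F x \<partial>PiM I \<nu>) + ennreal (real (card I) * e)"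
proof -
  have "\<exists>\<nu>. (\<forall>i. prob_space (\<nu> i)) \<and> (\<forall>i. sets (\<nu> i) = sets borel) \<and> (\<forall>i\<in>J. \<nu> i \<in> C i) \<and>
    (\<forall>i. i \<notin> J \<longrightarrow> \<nu> i = \<mu> i) \<and>
    (\<integral>\<^sup>+x. F x \<partial>PiM I \<mu>) \<le> (\<integral>\<^sup>+x. F x \<partial>PiM I \<nu>) + ennreal (real (card J) * e)"
    if "J \<subseteq> I" for J
    using finite_subset[OF that I] that
  proof (induction J rule: finite_induct)
    case empty
    show ?case using \<mu> by (intro exI[of _ \<mu>]) auto
  next
    case (insert j J)
    then have "J \<subseteq> I" by auto
    from insert.IH[OF this] obtain \<nu> where \<nu>: "\<forall>i. prob_space (\<nu> i)"
      "\<forall>i. sets (\<nu> i) = sets borel" "\<forall>i\<in>J. \<nu> i \<in> C i" "\<forall>i. i \<notin> J \<longrightarrow> \<nu> i = \<mu> i"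
      and le: "(\<integral>\<^sup>+x. F x \<partial>PiM I \<mu>) \<le> (\<integral>\<^sup>+x. F x \<partial>PiM I \<nu>) + ennreal (real (card J) * e)"
      by blast
    note p = \<nu>(1)[rule_format] and s = \<nu>(2)[rule_format]
      and \<nu>C = \<nu>(3)[rule_format] and \<nu>\<mu> = \<nu>(4)[rule_format]
    define K where "K = I - {j}"
    have K: "finite K" "j \<notin> K" "I = insert j K" using I insert.prems by (auto simp: K_def)
    define h where "h y = (\<integral>\<^sup>+x. F (x(j := y)) \<partial>PiM K \<nu>)" for y
    have split: "(\<integral>\<^sup>+x. F x \<partial>PiM I \<kappa>) = (\<integral>\<^sup>+y. h y \<partial>\<kappa> j)"
      if \<kappa>: "\<And>i. prob_space (\<kappa> i)" "\<And>i. sets (\<kappa> i) = sets borel" "\<And>i. i \<noteq> j \<Longrightarrow> \<kappa> i = \<nu> i" for \<kappa>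
    proof -
      interpret k: product_prob_space \<kappa> I
        using \<kappa>(1) by (simp add: product_prob_space_def product_prob_space_axioms_def
            product_sigma_finite_def prob_space_imp_sigma_finite)
      have FI: "F \<in> borel_measurable (PiM (insert j K) \<kappa>)"
        using F(1) \<kappa>(2) unfolding K(3)
        by (subst measurable_cong_sets[OF sets_PiM_cong refl]) auto
      have "PiM K \<kappa> = PiM K \<nu>" using \<kappa>(3) K by (intro PiM_cong refl) metis
      then show ?thesis
        unfolding h_def K(3) by (subst k.product_nn_integral_insert_rev[OF K(1,2) FI]) simp
    qed
    have h_meas: "h \<in> borel_measurable borel"
    proof -
      interpret n: product_prob_space \<nu> I
        using p by (simp add: product_prob_space_def product_prob_space_axioms_def
            product_sigma_finite_def prob_space_imp_sigma_finite)
      interpret nK: prob_space "PiM K \<nu>" by (intro prob_space_PiM p)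
      have [measurable]: "F \<in> borel_measurable (PiM (insert j K) \<nu>)"
        using F(1) s unfolding K(3)
        by (subst measurable_cong_sets[OF sets_PiM_cong refl]) auto
      have "h \<in> borel_measurable (\<nu> j)" unfolding h_def by measurable
      then show ?thesis using s by (simp cong: measurable_cong_sets)
    qed
    have h1: "h y \<le> 1" for y
    proof -
      interpret nK: prob_space "PiM K \<nu>" by (intro prob_space_PiM p)
      have "h y \<le> (\<integral>\<^sup>+x. 1 \<partial>PiM K \<nu>)" unfolding h_def by (intro nn_integral_mono F)
      then show ?thesis by (simp add: nK.emeasure_space_1)
    qed
    have jI: "j \<in> I" using insert.prems by auto
    from improve[OF jI h_meas h1] obtain \<eta> where \<eta>: "\<eta> \<in> C j"
      "(\<integral>\<^sup>+x. h x \<partial>\<mu> j) \<le> (\<integral>\<^sup>+x. h x \<partial>\<eta>) + ennreal e" by auto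
    define \<nu>' where "\<nu>' = \<nu>(j := \<eta>)"
    have p': "prob_space (\<nu>' i)" and s': "sets (\<nu>' i) = sets borel" for i
      using C[OF jI \<eta>(1)] p s by (auto simp: \<nu>'_def)
    have "(\<integral>\<^sup>+x. F x \<partial>PiM I \<nu>) = (\<integral>\<^sup>+y. h y \<partial>\<mu> j)"
      using split[of \<nu>] p s \<nu>\<mu>[of j] insert.hyps by simp
    also have "\<dots> \<le> (\<integral>\<^sup>+x. h x \<partial>\<eta>) + ennreal e" by fact
    also have "(\<integral>\<^sup>+x. h x \<partial>\<eta>) = (\<integral>\<^sup>+x. F x \<partial>PiM I \<nu>')"
      using split[of \<nu>'] p' s' by (simp add: \<nu>'_def)
    finally have "(\<integral>\<^sup>+x. F x \<partial>PiM I \<mu>)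
        \<le> (\<integral>\<^sup>+x. F x \<partial>PiM I \<nu>') + ennreal e + ennreal (real (card J) * e)"
      using le by (meson add_right_mono order_trans)
    also have "\<dots> = (\<integral>\<^sup>+x. F x \<partial>PiM I \<nu>') + ennreal (real (card (insert j J)) * e)"
      using e insert.hyps by (simp add: add.assoc algebra_simps flip: ennreal_plus)
    finally have final: "(\<integral>\<^sup>+x. F x \<partial>PiM I \<mu>)
        \<le> (\<integral>\<^sup>+x. F x \<partial>PiM I \<nu>') + ennreal (real (card (insert j J)) * e)" .
    show ?case
    proof (intro exI[of _ \<nu>'] conjI allI ballI impI)
      show "\<nu>' i \<in> C i" if "i \<in> insert j J" for i
        using that \<nu>C \<eta>(1) by (auto simp: \<nu>'_def)
      show "\<nu>' i = \<mu> i" if "i \<notin> insert j J" for i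
        using that \<nu>\<mu> by (auto simp: \<nu>'_def)
    qed (use p' s' final in auto)
  qed
  from this[of I] show ?thesis by auto
qed

section \<open>The maximal density and the laws that extremise it\<close>

lemma emeasure_distributed_eq_nn_integral:
  assumes "sets \<alpha> = sets borel" "distributed P \<alpha> Y f" "A \<in> sets borel"
  shows "emeasure P (Y -` A \<inter> space P) = (\<integral>\<^sup>+x. f x * indicator A x \<partial>\<alpha>)"
  using assms(1,3) by (intro distributed_emeasure[OF assms(2)]) simp

lemma emeasure_le_max_density:
  assumes "A \<in> sets borel" "0 < emeasure \<alpha> A" "emeasure \<alpha> A < top"
  shows "emeasure P (Y -` A \<inter> space P) \<le> max_density \<alpha> P Y * emeasure \<alpha> A"
proof -
  have "emeasure P (Y -` A \<inter> space P) / emeasure \<alpha> A \<le> max_density \<alpha> P Y"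
    unfolding max_density_def using assms by (intro SUP_upper) auto
  then have "emeasure P (Y -` A \<inter> space P) / emeasure \<alpha> A * emeasure \<alpha> A
      \<le> max_density \<alpha> P Y * emeasure \<alpha> A"
    by (rule mult_right_mono) simp
  then show ?thesis
    using assms by (simp add: ennreal_divide_times ennreal_divide_self)
qed

text \<open>
  The supremum in \<open>max_density\<close> bounds the density only through sets of finite measure, since a
  set of infinite measure contributes 0. If the density exceeded the supremum on a set of positive
  measure, non-atomicity would provide a subset of finite positive measure to test it on.
\<close>
lemma density_le_max_density_AE:
  assumes \<alpha>: "sets \<alpha> = sets borel" and na: "non_atomic \<alpha>"
    and Y: "distributed P \<alpha> Y f" and fin: "max_density \<alpha> P Y < top"
  shows "AE x in \<alpha>. f x \<le> max_density \<alpha> P Y"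
proof -
  define m where "m = max_density \<alpha> P Y"
  have [measurable]: "f \<in> borel_measurable \<alpha>" using Y by (simp add: distributed_def)
  define B where "B = {x\<in>space \<alpha>. m < f x}"
  have B[measurable]: "B \<in> sets \<alpha>" unfolding B_def by measurable
  have "emeasure \<alpha> B = 0"
  proof (rule ccontr)
    assume "emeasure \<alpha> B \<noteq> 0"
    then obtain C where C[measurable]: "C \<in> sets \<alpha>" and CB: "C \<subseteq> B" and C0: "0 < emeasure \<alpha> C"
      and "emeasure \<alpha> C < ennreal 1"
      using non_atomic_small_subset[OF na B, of 1] by (auto simp: zero_less_iff_neq_zero)
    then have Cfin: "emeasure \<alpha> C < top" by (auto intro: order.strict_trans)
    have "(\<integral>\<^sup>+x. (f x - m) * indicator C x \<partial>\<alpha>) + m * emeasure \<alpha> C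
        = (\<integral>\<^sup>+x. (f x - m) * indicator C x + m * indicator C x \<partial>\<alpha>)"
      by (subst nn_integral_add) (auto simp: nn_integral_cmult_indicator)
    also have "\<dots> = (\<integral>\<^sup>+x. f x * indicator C x \<partial>\<alpha>)"
      using CB by (intro nn_integral_cong)
        (auto simp: B_def indicator_def diff_add_self_ennreal less_imp_le)
    also have "\<dots> \<le> m * emeasure \<alpha> C"
      using emeasure_le_max_density[of C \<alpha> P Y] C C0 Cfin \<alpha>
        emeasure_distributed_eq_nn_integral[OF \<alpha> Y, of C] by (simp add: m_def)
    finally have "(\<integral>\<^sup>+x. (f x - m) * indicator C x \<partial>\<alpha>) + m * emeasure \<alpha> C \<le> 0 + m * emeasure \<alpha> C"
      by simp
    moreover have "m * emeasure \<alpha> C < top"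
      using fin Cfin by (auto simp: m_def ennreal_mult_less_top)
    ultimately have "(\<integral>\<^sup>+x. (f x - m) * indicator C x \<partial>\<alpha>) = 0"
      by (metis add.commute ennreal_add_left_cancel_le infinity_ennreal_def le_zero_eq less_irrefl)
    then have "AE x in \<alpha>. (f x - m) * indicator C x = 0"
      by (subst (asm) nn_integral_0_iff_AE) auto
    then have "AE x in \<alpha>. x \<notin> C"
    proof eventually_elim
      case (elim x)
      have "0 < f x - m" if "x \<in> C"
        using that CB by (intro diff_gr0_ennreal) (auto simp: B_def)
      then show ?case using elim by (cases "x \<in> C") auto
    qed
    then have "emeasure \<alpha> C = 0"
      using AE_iff_null_sets[OF C] by auto
    with C0 show False by simp
  qed
  then have "AE x in \<alpha>. x \<notin> B"
    using AE_iff_null_sets[OF B] B by auto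
  then show ?thesis
    using AE_space by eventually_elim (auto simp: B_def m_def)
qed

lemma max_density_uniform:
  assumes \<alpha>: "sets \<alpha> = sets borel" and U: "uniform_rv_on \<alpha> Q U S"
  shows "max_density \<alpha> Q U = 1 / emeasure \<alpha> S"
proof -
  have S: "S \<in> sets borel" "0 < emeasure \<alpha> S" "emeasure \<alpha> S < top"
    and dist: "distributed Q \<alpha> U (\<lambda>x. indicator S x / emeasure \<alpha> S)"
    using U by (auto simp: uniform_rv_on_def)
  have eq: "emeasure Q (U -` A \<inter> space Q) = emeasure \<alpha> (S \<inter> A) / emeasure \<alpha> S"
    if A: "A \<in> sets borel" for A
  proof -
    have "emeasure Q (U -` A \<inter> space Q) = (\<integral>\<^sup>+x. indicator S x / emeasure \<alpha> S * indicator A x \<partial>\<alpha>)"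
      by (rule emeasure_distributed_eq_nn_integral[OF \<alpha> dist A])
    also have "\<dots> = (\<integral>\<^sup>+x. indicator (S \<inter> A) x / emeasure \<alpha> S \<partial>\<alpha>)"
      by (intro nn_integral_cong) (auto simp: indicator_def)
    also have "\<dots> = emeasure \<alpha> (S \<inter> A) / emeasure \<alpha> S"
      using S(1) A \<alpha> by (subst nn_integral_divide) auto
    finally show ?thesis .
  qed
  show ?thesis
  proof (rule antisym)
    show "max_density \<alpha> Q U \<le> 1 / emeasure \<alpha> S"
      unfolding max_density_def
    proof (rule SUP_least)
      fix A :: "'a set" assume "A \<in> {A\<in>sets borel. 0 < emeasure \<alpha> A}"
      then have A: "A \<in> sets borel" "0 < emeasure \<alpha> A" by auto
      have "emeasure \<alpha> (S \<inter> A) \<le> emeasure \<alpha> A" using A \<alpha> by (intro emeasure_mono) auto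
      then have "emeasure Q (U -` A \<inter> space Q) / emeasure \<alpha> A
          \<le> emeasure \<alpha> A / emeasure \<alpha> S / emeasure \<alpha> A"
        unfolding eq[OF A(1)] by (intro divide_right_mono_ennreal)
      also have "\<dots> = (emeasure \<alpha> A / emeasure \<alpha> A) / emeasure \<alpha> S"
        by (simp add: divide_ennreal_def mult.assoc mult.left_commute mult.commute)
      also have "\<dots> \<le> 1 / emeasure \<alpha> S"
        using A(2) by (intro divide_right_mono_ennreal)
          (cases "emeasure \<alpha> A = top"; simp add: less_top)
      finally show "emeasure Q (U -` A \<inter> space Q) / emeasure \<alpha> A \<le> 1 / emeasure \<alpha> S" .
    qed
    have "1 / emeasure \<alpha> S = emeasure Q (U -` S \<inter> space Q) / emeasure \<alpha> S"
      unfolding eq[OF S(1)] using S by simp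
    also have "\<dots> \<le> max_density \<alpha> Q U"
      unfolding max_density_def using S by (intro SUP_upper) auto
    finally show "1 / emeasure \<alpha> S \<le> max_density \<alpha> Q U" .
  qed
qed

text \<open>
  The laws admissible in \<open>uniform_with_max_density\<close>, described without a sample space, so that they
  can be chosen before the random variables having these laws are constructed.
\<close>
definition extremal_law :: "'a::topological_space measure \<Rightarrow> ennreal \<Rightarrow> 'a measure \<Rightarrow> bool" where
  "extremal_law \<alpha> m \<nu> \<longleftrightarrow>
     (if m = \<infinity> then \<exists>x. \<nu> = return borel x
      else \<exists>S\<in>sets borel. 0 < emeasure \<alpha> S \<and> emeasure \<alpha> S < top \<and> m = 1 / emeasure \<alpha> S \<and>
        \<nu> = density \<alpha> (\<lambda>x. indicator S x / emeasure \<alpha> S))"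

lemma extremal_law_prob_space:
  assumes \<alpha>: "sets \<alpha> = sets borel" and law: "extremal_law \<alpha> m \<nu>"
  shows "prob_space \<nu> \<and> sets \<nu> = sets borel"
proof (cases "m = \<infinity>")
  case True
  then obtain x where "\<nu> = return borel x" using law by (auto simp: extremal_law_def)
  then show ?thesis by (simp add: prob_space_return)
next
  case False
  then obtain S where S: "S \<in> sets borel" "0 < emeasure \<alpha> S" "emeasure \<alpha> S < top"
    and \<nu>: "\<nu> = density \<alpha> (\<lambda>x. indicator S x / emeasure \<alpha> S)"
    using law by (auto simp: extremal_law_def)
  have S'[measurable]: "S \<in> sets \<alpha>" using S \<alpha> by simp
  have "emeasure \<nu> (space \<nu>) = (\<integral>\<^sup>+x. indicator S x / emeasure \<alpha> S * indicator (space \<alpha>) x \<partial>\<alpha>)"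
    unfolding \<nu> by (subst emeasure_density) auto
  also have "\<dots> = (\<integral>\<^sup>+x. indicator S x / emeasure \<alpha> S \<partial>\<alpha>)"
    by (intro nn_integral_cong) simp
  also have "\<dots> = 1" using S S' by (subst nn_integral_divide) auto
  finally have "prob_space \<nu>" by (rule prob_spaceI)
  then show ?thesis using \<alpha> \<nu> by simp
qed

lemma uniform_with_max_density_of_law:
  assumes \<alpha>: "sets \<alpha> = sets borel" and U: "U \<in> Q \<rightarrow>\<^sub>M borel"
    and law: "extremal_law \<alpha> m (distr Q borel U)"
  shows "uniform_with_max_density \<alpha> Q U m"
proof (cases "m = \<infinity>")
  case True
  then show ?thesis using law by (auto simp: extremal_law_def uniform_with_max_density_def)
next
  case False
  then obtain S where S: "S \<in> sets borel" "0 < emeasure \<alpha> S" "emeasure \<alpha> S < top"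
    and m: "m = 1 / emeasure \<alpha> S"
    and d: "distr Q borel U = density \<alpha> (\<lambda>x. indicator S x / emeasure \<alpha> S)"
    using law by (auto simp: extremal_law_def)
  have "distr Q \<alpha> U = distr Q borel U" by (rule distr_cong) (auto simp: \<alpha>)
  then have "uniform_rv_on \<alpha> Q U S"
    using S d U \<alpha> unfolding uniform_rv_on_def distributed_def
    by (auto cong: measurable_cong_sets)
  then show ?thesis
    using max_density_uniform[OF \<alpha>] m False unfolding uniform_with_max_density_def by auto
qed

text \<open>
  The two kinds of extremal laws, combined. In the bounded case \<open>m > 0\<close>, as \<open>f\<close> has integral 1, and the
  whole group has measure at least \<open>1 / m\<close>, so that it has room for a set of this measure.
\<close>
lemma exists_extremal_law_increasing:
  assumes \<alpha>: "sets \<alpha> = sets borel" and na: "non_atomic \<alpha>"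
    and "prob_space P" and Y: "distributed P \<alpha> Y f"
    and h: "h \<in> borel_measurable borel" "\<And>x. h x \<le> 1" and e: "0 < e"
  shows "\<exists>\<nu>. extremal_law \<alpha> (max_density \<alpha> P Y) \<nu> \<and>
    (\<integral>\<^sup>+x. h x \<partial>distr P borel Y) \<le> (\<integral>\<^sup>+x. h x \<partial>\<nu>) + ennreal e"
proof -
  interpret P: prob_space P by fact
  define m where "m = max_density \<alpha> P Y"
  have Ym: "Y \<in> P \<rightarrow>\<^sub>M borel" and fm[measurable]: "f \<in> borel_measurable \<alpha>"
    using Y \<alpha> by (auto simp: distributed_def cong: measurable_cong_sets)
  have hm[measurable]: "h \<in> borel_measurable \<alpha>" using h \<alpha> by (simp cong: measurable_cong_sets)
  have sp: "space \<alpha> = UNIV" using sets_eq_imp_space_eq[OF \<alpha>] by simp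
  show ?thesis
  proof (cases "m = \<infinity>")
    case True
    obtain x where "(\<integral>\<^sup>+x. h x \<partial>distr P borel Y) \<le> h x + ennreal e"
      using exists_point_ge_nn_integral[OF P.prob_space_distr[OF Ym], of h e] h(2) e by auto
    then show ?thesis
      using True h(1) by (intro exI[of _ "return borel x"])
        (auto simp: extremal_law_def m_def nn_integral_return)
  next
    case False
    have law: "distr P borel Y = density \<alpha> f"
    proof -
      have "distr P borel Y = distr P \<alpha> Y" using \<alpha> by (intro distr_cong) auto
      then show ?thesis using Y by (simp add: distributed_def)
    qed
    have f1: "(\<integral>\<^sup>+x. f x \<partial>\<alpha>) = 1"
      using emeasure_distributed_eq_nn_integral[OF \<alpha> Y, of UNIV] by (simp add: P.emeasure_space_1)
    have fle: "AE x in \<alpha>. f x \<le> m"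
      unfolding m_def by (rule density_le_max_density_AE[OF \<alpha> na Y])
        (use False in \<open>simp add: m_def less_top\<close>)
    have "m \<noteq> 0"
    proof
      assume "m = 0"
      then have "(\<integral>\<^sup>+x. f x \<partial>\<alpha>) = 0" using fle by (subst nn_integral_0_iff_AE) auto
      then show False using f1 by simp
    qed
    then obtain r where r: "0 < r" "m = ennreal r"
      using False by (metis ennreal_eq_0_iff infinity_ennreal_def less_top less_top_ennreal not_less order_le_less)
    define c where "c = 1 / r"
    have c: "0 < c" "1 / ennreal c = m"
      using r by (auto simp: c_def divide_ennreal simp flip: ennreal_1)
    have \<alpha>0: "0 < emeasure \<alpha> UNIV"
    proof (rule ccontr)
      assume "\<not> 0 < emeasure \<alpha> UNIV"
      then have "AE x in \<alpha>. f x = 0"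
        using sp by (intro AE_I[of _ _ UNIV]) (auto simp: \<alpha>)
      then have "(\<integral>\<^sup>+x. f x \<partial>\<alpha>) = 0" by (subst nn_integral_0_iff_AE) auto
      then show False using f1 by simp
    qed
    have "ennreal c \<le> emeasure \<alpha> (space \<alpha>)"
    proof (cases "emeasure \<alpha> UNIV = top")
      case False
      then have "1 \<le> m * emeasure \<alpha> UNIV"
        using emeasure_le_max_density[of UNIV \<alpha> P Y] \<alpha>0 by (simp add: m_def less_top P.emeasure_space_1)
      moreover obtain a where a: "0 \<le> a" "emeasure \<alpha> UNIV = ennreal a"
        using False by (metis less_top less_top_ennreal)
      ultimately have "1 \<le> r * a" using r by (simp flip: ennreal_mult ennreal_1)
      then show ?thesis using a r sp by (auto simp: c_def field_simps intro!: ennreal_leI)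
    qed (simp add: sp)
    from bathtub_uniform_density[OF na fm hm f1 _ c(1) this h(2) e] fle c(2)
    obtain S where S[measurable]: "S \<in> sets \<alpha>" "emeasure \<alpha> S = ennreal c"
      and le: "(\<integral>\<^sup>+x. f x * h x \<partial>\<alpha>) \<le> (\<integral>\<^sup>+x. (indicator S x / emeasure \<alpha> S) * h x \<partial>\<alpha>) + ennreal e"
      by auto
    define \<nu> where "\<nu> = density \<alpha> (\<lambda>x. indicator S x / emeasure \<alpha> S)"
    have "extremal_law \<alpha> m \<nu>"
      unfolding extremal_law_def \<nu>_def using False S c \<alpha> by (auto intro!: bexI[of _ S])
    moreover have "(\<integral>\<^sup>+x. h x \<partial>distr P borel Y) \<le> (\<integral>\<^sup>+x. h x \<partial>\<nu>) + ennreal e"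
      using le unfolding law \<nu>_def by (simp add: nn_integral_density)
    ultimately show ?thesis unfolding m_def by blast
  qed
qed

section \<open>Realising the replaced laws on a product space\<close>

lemma indep_vars_coordinates:
  fixes \<nu> :: "'i \<Rightarrow> 'a::topological_space measure"
  assumes "I \<noteq> {}" and p: "\<And>i. prob_space (\<nu> i)" and s: "\<And>i. sets (\<nu> i) = sets borel"
  shows "prob_space.indep_vars (PiM I \<nu>) (\<lambda>_. borel) (\<lambda>i x. x i) I"
    and "\<And>i. i \<in> I \<Longrightarrow> (\<lambda>x. x i) \<in> PiM I \<nu> \<rightarrow>\<^sub>M borel"
    and "\<And>i. i \<in> I \<Longrightarrow> distr (PiM I \<nu>) borel (\<lambda>x. x i) = \<nu> i"
proof -
  interpret Q: prob_space "PiM I \<nu>" by (intro prob_space_PiM p)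
  show m: "(\<lambda>x. x i) \<in> PiM I \<nu> \<rightarrow>\<^sub>M borel" if "i \<in> I" for i
    using measurable_component_singleton[OF that, of \<nu>] s by (simp cong: measurable_cong_sets)
  show d: "distr (PiM I \<nu>) borel (\<lambda>x. x i) = \<nu> i" if "i \<in> I" for i
  proof -
    have "distr (PiM I \<nu>) borel (\<lambda>x. x i) = distr (PiM I \<nu>) (\<nu> i) (\<lambda>x. x i)"
      using s by (intro distr_cong) auto
    then show ?thesis using distr_PiM_component[OF p that] by simp
  qed
  have sets: "sets (PiM I (\<lambda>_. borel)) = sets (PiM I \<nu>)" using s by (intro sets_PiM_cong) auto
  have "distr (PiM I \<nu>) (PiM I (\<lambda>_. borel)) (\<lambda>x. \<lambda>i\<in>I. x i)
      = distr (PiM I \<nu>) (PiM I (\<lambda>_. borel)) (\<lambda>x. x)"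
    by (intro distr_cong refl) (auto simp: space_PiM)
  also have "\<dots> = PiM I \<nu>" by (rule distr_id2[OF sets])
  also have "\<dots> = (\<Pi>\<^sub>M i\<in>I. distr (PiM I \<nu>) borel (\<lambda>x. x i))"
    by (intro PiM_cong refl) (simp add: d)
  finally show "Q.indep_vars (\<lambda>_. borel) (\<lambda>i x. x i) I"
    using Q.indep_vars_iff_distr_eq_PiM'[OF assms(1), where M'="\<lambda>_. borel" and X="\<lambda>i x. x i"] m by blast
qed

lemma measurable_ordered_product:
  "ordered_product n (\<lambda>i x. x i)
     \<in> PiM {1..n} (\<lambda>_. borel) \<rightarrow>\<^sub>M (borel :: 'a::{second_countable_topology, topological_monoid_add} measure)"
proof -
  have "(\<lambda>x. sum_list (map (\<lambda>i. x i :: 'a) js)) \<in> borel_measurable (PiM {1..n} (\<lambda>_. borel))"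
    if "set js \<subseteq> {1..n}" for js
    using that by (induction js) auto
  from this[of "[1..<Suc n]"] show ?thesis
    unfolding ordered_product_def[abs_def] by (simp only: set_upt atLeastLessThanSuc_atLeastAtMost order_refl)
qed

theorem theorem1p6:
  fixes \<alpha> :: "'a::{polish_space, topological_group_add} measure"
    and P :: "'b measure"
    and X :: "nat \<Rightarrow> 'b \<Rightarrow> 'a"
    and f :: "nat \<Rightarrow> 'a \<Rightarrow> ennreal"
    and n :: nat
  assumes "locally_compact_space (euclidean :: 'a topology)"
    and "sigma_compact (UNIV :: 'a set)"
    and "left_haar_measure \<alpha>"
    and "non_atomic \<alpha>"
    and "n \<ge> 1"
    and "prob_space P"
    and "prob_space.indep_vars P (\<lambda>_. borel) X {1..n}"
    and "\<And>i. i \<in> {1..n} \<Longrightarrow> distributed P \<alpha> (X i) (f i)"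
  shows "max_density \<alpha> P (ordered_product n X)
       \<le> (SUP (Q, U)\<in>uniform_competitors \<alpha> n (\<lambda>i. max_density \<alpha> P (X i)).
            max_density \<alpha> Q (ordered_product n U))"
    (is "_ \<le> ?sup")
proof -
  interpret P: prob_space P by fact
  have \<alpha>: "sets \<alpha> = sets borel" using assms(3) by (simp add: left_haar_measure_def)
  define I where "I = {1..n}"
  have I: "finite I" "I \<noteq> {}" "card I = n" using assms(5) by (auto simp: I_def)
  define G :: "(nat \<Rightarrow> 'a) \<Rightarrow> 'a" where "G = ordered_product n (\<lambda>i x. x i)"
  have G[measurable]: "G \<in> PiM I (\<lambda>_. borel) \<rightarrow>\<^sub>M borel"
    unfolding G_def I_def by (rule measurable_ordered_product)
  have X: "X i \<in> P \<rightarrow>\<^sub>M borel" if "i \<in> I" for i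
    using assms(8) that \<alpha> by (auto simp: I_def distributed_def cong: measurable_cong_sets)
  \<comment> \<open>The default value outside \<open>I\<close> only makes every \<open>\<mu> i\<close> a probability measure.\<close>
  define \<mu> where "\<mu> i = (if i \<in> I then distr P borel (X i) else return borel 0)" for i
  have \<mu>: "prob_space (\<mu> i)" "sets (\<mu> i) = sets borel" for i
    using X by (auto simp: \<mu>_def intro!: P.prob_space_distr prob_space_return)
  have joint: "distr P (PiM I (\<lambda>_. borel)) (\<lambda>\<omega>. \<lambda>i\<in>I. X i \<omega>) = PiM I \<mu>"
  proof -
    have "distr P (PiM I (\<lambda>_. borel)) (\<lambda>\<omega>. \<lambda>i\<in>I. X i \<omega>) = PiM I (\<lambda>i. distr P borel (X i))"
      using P.indep_vars_iff_distr_eq_PiM'[OF I(2), where M'="\<lambda>_. borel" and X=X] X assms(7)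
      by (simp add: I_def)
    also have "\<dots> = PiM I \<mu>" by (intro PiM_cong) (auto simp: \<mu>_def)
    finally show ?thesis .
  qed
  have G_restrict: "G (\<lambda>i\<in>I. X i \<omega>) = ordered_product n X \<omega>" for \<omega>
    unfolding G_def ordered_product_def I_def by (intro arg_cong[of _ _ sum_list] map_cong) auto
  have bound: "emeasure P (ordered_product n X -` A \<inter> space P) / emeasure \<alpha> A \<le> ?sup"
    if A: "A \<in> sets borel" "0 < emeasure \<alpha> A" for A
  proof (cases "emeasure \<alpha> A = top")
    case False
    then obtain a where a: "0 < a" "emeasure \<alpha> A = ennreal a"
      using A(2) by (metis ennreal_less_zero_iff less_top less_top_ennreal)
    define F :: "(nat \<Rightarrow> 'a) \<Rightarrow> ennreal" where "F x = indicator A (G x)" for x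
    have F: "F \<in> borel_measurable (PiM I (\<lambda>_. borel))" unfolding F_def using A(1) by measurable
    have F1: "F x \<le> 1" for x by (simp add: F_def indicator_def)
    have intP: "emeasure P (ordered_product n X -` A \<inter> space P) = (\<integral>\<^sup>+x. F x \<partial>PiM I \<mu>)"
    proof -
      have Xm: "(\<lambda>\<omega>. \<lambda>i\<in>I. X i \<omega>) \<in> P \<rightarrow>\<^sub>M PiM I (\<lambda>_. borel)"
        using X by (intro measurable_restrict)
      have "(\<integral>\<^sup>+x. F x \<partial>PiM I \<mu>) = (\<integral>\<^sup>+\<omega>. F (\<lambda>i\<in>I. X i \<omega>) \<partial>P)"
        unfolding joint[symmetric] using F by (intro nn_integral_distr[OF Xm]) simp
      also have "\<dots> = (\<integral>\<^sup>+\<omega>. indicator (ordered_product n X -` A \<inter> space P) \<omega> \<partial>P)"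
        by (intro nn_integral_cong) (auto simp: F_def G_restrict indicator_def)
      also have "\<dots> = emeasure P (ordered_product n X -` A \<inter> space P)"
      proof (rule nn_integral_indicator)
        have "ordered_product n X = G \<circ> (\<lambda>\<omega>. \<lambda>i\<in>I. X i \<omega>)" by (auto simp: G_restrict)
        then have "ordered_product n X \<in> P \<rightarrow>\<^sub>M borel" using measurable_comp[OF Xm G] by simp
        then show "ordered_product n X -` A \<inter> space P \<in> sets P" using A(1) by (rule measurable_sets)
      qed
      finally show ?thesis by simp
    qed
    show ?thesis
    proof (rule ennreal_le_epsilon)
      fix e :: real assume e: "0 < e"
      \<comment> \<open>Each of the \<open>n\<close> replacements costs \<open>e'\<close>, so together they cost \<open>e * a\<close>, which the division
        by the measure \<open>a\<close> of \<open>A\<close> turns into \<open>e\<close>.\<close>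
      define e' where "e' = e * a / real n"
      have e': "0 < e'" using e a assms(5) by (simp add: e'_def)
      define C where "C i = Collect (extremal_law \<alpha> (max_density \<alpha> P (X i)))" for i
      obtain \<nu> where \<nu>: "\<And>i. prob_space (\<nu> i)" "\<And>i. sets (\<nu> i) = sets borel"
          "\<And>i. i \<in> I \<Longrightarrow> \<nu> i \<in> C i"
        and le: "(\<integral>\<^sup>+x. F x \<partial>PiM I \<mu>) \<le> (\<integral>\<^sup>+x. F x \<partial>PiM I \<nu>) + ennreal (real (card I) * e')"
      proof -
        have improve: "\<exists>\<nu>\<in>C i. (\<integral>\<^sup>+x. h x \<partial>\<mu> i) \<le> (\<integral>\<^sup>+x. h x \<partial>\<nu>) + ennreal e'"
          if "i \<in> I" "h \<in> borel_measurable borel" "\<And>x. h x \<le> 1" for i h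
          using exists_extremal_law_increasing[OF \<alpha> assms(4,6) assms(8) that(2,3) e', of i] that(1)
          by (auto simp: C_def \<mu>_def I_def)
        have "\<exists>\<nu>. (\<forall>i. prob_space (\<nu> i)) \<and> (\<forall>i. sets (\<nu> i) = sets borel) \<and> (\<forall>i\<in>I. \<nu> i \<in> C i) \<and>
          (\<integral>\<^sup>+x. F x \<partial>PiM I \<mu>) \<le> (\<integral>\<^sup>+x. F x \<partial>PiM I \<nu>) + ennreal (real (card I) * e')"
        proof (rule replace_laws_one_by_one[OF I(1) \<mu> _ _ F F1])
          show "prob_space \<nu> \<and> sets \<nu> = sets borel" if "\<nu> \<in> C i" for i \<nu>
            using extremal_law_prob_space[OF \<alpha>, of "max_density \<alpha> P (X i)"] that by (simp add: C_def)
          show "0 \<le> e'" using e' by simp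
        qed (use improve in auto)
        with that show ?thesis by blast
      qed
      define Q where "Q = PiM I \<nu>"
      define U :: "nat \<Rightarrow> (nat \<Rightarrow> 'a) \<Rightarrow> 'a" where "U = (\<lambda>i x. x i)"
      note coord = indep_vars_coordinates[OF I(2) \<nu>(1,2)]
      have comp: "(Q, U) \<in> uniform_competitors \<alpha> n (\<lambda>i. max_density \<alpha> P (X i))"
      proof -
        have "uniform_with_max_density \<alpha> Q (U i) (max_density \<alpha> P (X i))" if "i \<in> I" for i
          unfolding Q_def U_def
          using coord(2,3)[OF that] \<nu>(3)[OF that]
          by (intro uniform_with_max_density_of_law[OF \<alpha>]) (auto simp: C_def)
        moreover have "prob_space Q" unfolding Q_def by (intro prob_space_PiM \<nu>)
        ultimately show ?thesis
          using coord(1) by (simp add: uniform_competitors_def Q_def U_def I_def)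
      qed
      have "(\<integral>\<^sup>+x. F x \<partial>Q) = (\<integral>\<^sup>+x. indicator (ordered_product n U -` A \<inter> space Q) x \<partial>Q)"
        by (intro nn_integral_cong) (auto simp: F_def G_def U_def indicator_def)
      also have "\<dots> = emeasure Q (ordered_product n U -` A \<inter> space Q)"
      proof (rule nn_integral_indicator)
        have "sets Q = sets (PiM I (\<lambda>_. borel))" unfolding Q_def using \<nu>(2) by (intro sets_PiM_cong) auto
        then have "G \<in> Q \<rightarrow>\<^sub>M borel" using G by (simp cong: measurable_cong_sets)
        then show "ordered_product n U -` A \<inter> space Q \<in> sets Q"
          using A(1) unfolding G_def U_def by (rule measurable_sets)
      qed
      finally have intQ: "(\<integral>\<^sup>+x. F x \<partial>Q) = emeasure Q (ordered_product n U -` A \<inter> space Q)" .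
      have "emeasure P (ordered_product n X -` A \<inter> space P) / emeasure \<alpha> A
          \<le> (emeasure Q (ordered_product n U -` A \<inter> space Q) + ennreal (e * a)) / emeasure \<alpha> A"
        using le assms(5) unfolding intP Q_def[symmetric] intQ I(3) e'_def
        by (intro divide_right_mono_ennreal) simp
      also have "\<dots> = emeasure Q (ordered_product n U -` A \<inter> space Q) / emeasure \<alpha> A + ennreal e"
        using a e by (simp add: divide_ennreal_def distrib_right)
          (simp add: divide_ennreal_def[symmetric] divide_ennreal)
      also have "\<dots> \<le> max_density \<alpha> Q (ordered_product n U) + ennreal e"
        unfolding max_density_def using A by (intro add_right_mono SUP_upper) auto
      also have "\<dots> \<le> ?sup + ennreal e"
        using comp by (intro add_right_mono SUP_upper2[of "(Q, U)"]) auto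
      finally show "emeasure P (ordered_product n X -` A \<inter> space P) / emeasure \<alpha> A \<le> ?sup + ennreal e" .
    qed
  qed simp
  show ?thesis
    by (subst max_density_def, rule SUP_least) (use bound in auto)
qed

end
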